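(* Let $r\ge 1$, let $\mathbf a=(a_1,\ldots,a_r)$ be a sequence of positive integers, and let $D$ be a positive common multiple of $a_1,\ldots,a_r$. Write the restricted partition function as the quasi-polynomial $p_{\mathbf a}(n)=d_{\mathbf a,r-1}(n)n^{r-1}+\cdots+d_{\mathbf a,1}(n)n+d_{\mathbf a,0}(n)$ with $d_{\mathbf a,m}(n+D)=d_{\mathbf a,m}(n)$ for $0\le m\le r-1$, $n\ge 0$. (1) For $0\leq m\leq r-1$ and $n\geq 0$ we have $$d_{\mathbf a, m}(n) =\frac{1}{(r-1)!} \sum_{\substack{0\leq j_1\leq \frac{D}{a_1}-1,\ldots, 0\leq j_r\leq \frac{D}{a_r}-1 \\ a_1j_1+\cdots+a_rj_r \equiv n \ (\mathrm{mod}\ D)}} \ \sum_{k=m}^{r-1} \genfrac{[}{]}{0pt}{}{r}{k} (-1)^{k-m} \binom{k}{m} D^{-k} (a_1j_1 + \cdots + a_rj_r)^{k-m}.$$ (2) For $n\ge 0$ we have $$p_{\mathbf a}(n) = \frac{1}{(r-1)!} \sum_{m=0}^{r-1} \sum_{\substack{0\leq j_1\leq \frac{D}{a_1}-1,\ldots, 0\leq j_r\leq \frac{D}{a_r}-1 \\ a_1j_1+\cdots+a_rj_r \equiv n \ (\mathrm{mod}\ D)}} \ \sum_{k=m}^{r-1} \genfrac{[}{]}{0pt}{}{r}{k} (-1)^{k-m} \binom{k}{m} D^{-k} (a_1j_1 + \cdots + a_rj_r)^{k-m} n^m.$$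
   Context: $p_{\mathbf a}(n)$ (the restricted partition function) is the number of integer solutions $(x_1,\ldots,x_r)$ of $\sum_{i=1}^r a_ix_i=n$ with all $x_i\ge 0$, for $n\ge 0$. By a classical theorem of Bell, $p_{\mathbf a}$ is a quasi-polynomial of degree $r-1$ with period $D$, i.e. it has the displayed form with $D$-periodic coefficients $d_{\mathbf a,m}$ (which are uniquely determined) and $d_{\mathbf a,r-1}$ not identically zero. The symbols $\genfrac{[}{]}{0pt}{}{r}{k}$, $0\le k\le r-1$ (unsigned Stirling numbers of the first kind in the paper's indexing), are defined by $$(x+1)(x+2)\cdots(x+r-1)=\sum_{k=0}^{r-1}\genfrac{[}{]}{0pt}{}{r}{k}x^k$$ (the left side being $1$ for $r=1$). Convention: $0^0=1$. *)

theory Defs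
  imports
    Complex_Main
    "HOL-Library.FuncSet"
    "HOL-Number_Theory.Cong"
    "HOL-Computational_Algebra.Polynomial"
    "HOL-Combinatorics.Stirling"
begin

text \<open>
  A sequence of length \<open>r\<close> is a function on the index set \<open>{1..r}\<close>; tuples that are counted or summed
  over are taken in the extensional function space, so that each tuple occurs exactly once.
\<close>

definition restricted_partition :: "(nat \<Rightarrow> nat) \<Rightarrow> nat \<Rightarrow> nat \<Rightarrow> nat" where
  "restricted_partition a r n =
     card {x \<in> {1..r} \<rightarrow>\<^sub>E (UNIV :: nat set). (\<Sum>i=1..r. a i * x i) = n}"

text \<open>
  \<open>quasi_poly_rep f r D d\<close>: for all \<open>n\<close>, \<open>f n = d (r - 1) n * n ^ (r - 1) + \<dots> + d 0 n\<close> with every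
  \<open>d m\<close> periodic modulo \<open>D\<close>.
\<close>

definition quasi_poly_rep ::
  "(nat \<Rightarrow> real) \<Rightarrow> nat \<Rightarrow> nat \<Rightarrow> (nat \<Rightarrow> nat \<Rightarrow> real) \<Rightarrow> bool" where
  "quasi_poly_rep f r D d \<longleftrightarrow>
     (\<forall>m<r. \<forall>n. d m (n + D) = d m n) \<and>
     (\<forall>n. f n = (\<Sum>m<r. d m n * real n ^ m))"

text \<open>
  The representation determines \<open>d m\<close> only for \<open>m < r\<close>; padding by \<open>0\<close> makes the whole family unique,
  so that the definite description is meaningful whenever a representation exists.
\<close>

definition quasi_poly_coeff ::
  "(nat \<Rightarrow> real) \<Rightarrow> nat \<Rightarrow> nat \<Rightarrow> nat \<Rightarrow> nat \<Rightarrow> real" where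
  "quasi_poly_coeff f r D =
     (THE d. quasi_poly_rep f r D d \<and> (\<forall>m\<ge>r. \<forall>n. d m n = 0))"

definition partition_coeff ::
  "(nat \<Rightarrow> nat) \<Rightarrow> nat \<Rightarrow> nat \<Rightarrow> nat \<Rightarrow> nat \<Rightarrow> real" where
  "partition_coeff a r D = quasi_poly_coeff (\<lambda>n. real (restricted_partition a r n)) r D"

text \<open>
  The coefficient of \<open>x ^ k\<close> in \<open>(x + 1) * (x + 2) * \<dots> * (x + r - 1)\<close>. The lower index is shifted by one
  relative to \<^const>\<open>stirling\<close>, see \<open>rising_stirling_eq_stirling\<close>.
\<close>

definition rising_stirling :: "nat \<Rightarrow> nat \<Rightarrow> nat" where
  "rising_stirling r k = coeff (\<Prod>i=1..<r. [:i, 1:]) k"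

lemma rising_stirling_eq_stirling:
  "r \<ge> 1 \<Longrightarrow> rising_stirling r k = stirling r (Suc k)"
proof (induction r arbitrary: k rule: dec_induct)
  case base
  then show ?case by (cases k) (auto simp: rising_stirling_def)
next
  case (step r)
  have "(\<Prod>i=1..<Suc r. [:i, 1:]) = [:r, 1:] * (\<Prod>i=1..<r. [:i, 1:])"
    using step.hyps by (simp add: mult.commute)
  then have "rising_stirling (Suc r) k =
      r * rising_stirling r k + (case k of 0 \<Rightarrow> 0 | Suc j \<Rightarrow> rising_stirling r j)"
    by (simp add: rising_stirling_def coeff_pCons split: nat.split)
  moreover have "stirling r 0 = 0"
    using step.hyps by (cases r) auto
  ultimately show ?case
    using step.IH by (auto split: nat.split)
qed

definition residue_tuples :: "(nat \<Rightarrow> nat) \<Rightarrow> nat \<Rightarrow> nat \<Rightarrow> nat \<Rightarrow> (nat \<Rightarrow> nat) set" where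
  "residue_tuples a r D n =
     {j \<in> (\<Pi>\<^sub>E i\<in>{1..r}. {0..D div a i - 1}). [(\<Sum>i=1..r. a i * j i) = n] (mod D)}"

end

theory Submission
  imports Defs
begin

text \<open>
  Since \<open>a\<^sub>i\<close> divides \<open>D\<close>, division of \<open>x\<^sub>i\<close> by \<open>D / a\<^sub>i\<close> with remainder, \<open>x\<^sub>i = j\<^sub>i + (D / a\<^sub>i) q\<^sub>i\<close>,
  gives \<open>a\<^sub>i x\<^sub>i = a\<^sub>i j\<^sub>i + D q\<^sub>i\<close>: all quotients acquire the same weight \<open>D\<close>. With
  \<open>S = a\<^sub>1 j\<^sub>1 + \<dots> + a\<^sub>r j\<^sub>r\<close>, the solutions of \<open>a\<^sub>1 x\<^sub>1 + \<dots> + a\<^sub>r x\<^sub>r = n\<close> with remainders \<open>j\<close>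
  therefore correspond to the \<open>q\<close> with \<open>q\<^sub>1 + \<dots> + q\<^sub>r = (n - S) / D\<close>, which stars and bars counts
  (\<open>card_solutions_by_residues\<close>, \<open>card_fun_sum_eq\<close>). Only \<open>S\<close> congruent to \<open>n\<close> modulo \<open>D\<close> contribute.

  Put \<open>x = (n - S) / D\<close>. If \<open>S \<le> n\<close>, the count is the value at \<open>x\<close> of the polynomial
  \<open>(x + 1) \<dots> (x + r - 1) / (r - 1)!\<close>. If \<open>S > n\<close>, there is no solution, and the polynomial agrees:
  each \<open>a\<^sub>i j\<^sub>i\<close> is less than \<open>D\<close>, so \<open>S < r D\<close>, and \<open>x\<close> is one of the roots
  \<open>-1, \<dots>, -(r - 1)\<close> (\<open>card_quotients_eq_pochhammer\<close>). Hence the condition \<open>S \<le> n\<close>, which would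
  destroy periodicity in \<open>n\<close>, can be dropped from the sum over \<open>j\<close>.

  Expanding this polynomial in powers of \<open>x\<close> introduces the Stirling numbers, and expanding the powers
  of \<open>n - S\<close> by the binomial theorem gives the second formula. In it the factor of \<open>n\<^sup>m\<close> depends
  only on the residue of \<open>n\<close> modulo \<open>D\<close>. So it is a quasi-polynomial representation, and the first
  formula follows because such a representation is unique (\<open>quasi_poly_rep_unique\<close>).
\<close>

section \<open>Stars and bars\<close>

text \<open>
  Reading off values along an enumeration of \<open>I\<close> reduces this to the count of lists with given
  length and sum.
\<close>

lemma card_fun_sum_eq:
  fixes I :: "'a set"
  assumes "finite I"
  shows "card {q \<in> I \<rightarrow>\<^sub>E (UNIV :: nat set). sum q I = N} = (N + card I - 1) choose N"
proof -
  obtain ys where ys: "set ys = I" "distinct ys"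
    using finite_distinct_list[OF assms] by blast
  let ?A = "{q \<in> I \<rightarrow>\<^sub>E (UNIV :: nat set). sum q I = N}"
  let ?L = "{l :: nat list. size l = length ys \<and> sum_list l = N}"
  have "bij_betw (\<lambda>q. map q ys) ?A ?L"
  proof (rule bij_betw_imageI)
    show "inj_on (\<lambda>q. map q ys) ?A"
      by (rule inj_onI) (auto simp: ys(1)[symmetric] intro: PiE_ext)
    show "(\<lambda>q. map q ys) ` ?A = ?L"
    proof (intro equalityI subsetI)
      fix l assume "l \<in> (\<lambda>q. map q ys) ` ?A"
      then show "l \<in> ?L"
        using ys by (auto simp: sum_list_distinct_conv_sum_set)
    next
      fix l assume l: "l \<in> ?L"
      define q where "q = restrict (\<lambda>i. the (map_of (zip ys l) i)) I"
      have q: "map q ys = l"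
      proof (rule nth_equalityI)
        fix i assume "i < length (map q ys)"
        then show "map q ys ! i = l ! i"
          using l ys map_of_zip_nth[of ys l i] by (auto simp: q_def)
      qed (use l in auto)
      have "sum q I = sum_list (map q ys)"
        using ys by (simp add: sum_list_distinct_conv_sum_set)
      then have "q \<in> ?A"
        using q l by (auto simp: q_def)
      then show "l \<in> (\<lambda>q. map q ys) ` ?A"
        using q by blast
    qed
  qed
  then have "card ?A = card ?L"
    by (rule bij_betw_same_card)
  also have "\<dots> = (N + length ys - 1) choose N"
    by (rule card_length_sum_list)
  also have "length ys = card I"
    using ys distinct_card by metis
  finally show ?thesis .
qed

section \<open>Splitting a solution into residues and quotients\<close>

text \<open>
  The map from \<open>(j, q)\<close> to the tuple of all \<open>j\<^sub>i + (D / a\<^sub>i) q\<^sub>i\<close> is a bijection by uniqueness of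
  division with remainder. The congruence condition on \<open>j\<close> only removes empty fibres; it is what makes
  the index set depend on \<open>n\<close> only through its residue.
\<close>

lemma card_solutions_by_residues:
  fixes a :: "'i \<Rightarrow> nat"
  assumes "finite I" and "D > 0" and dvd: "\<And>i. i \<in> I \<Longrightarrow> a i dvd D"
  shows "card {x \<in> I \<rightarrow>\<^sub>E (UNIV :: nat set). (\<Sum>i\<in>I. a i * x i) = n} =
    (\<Sum>j\<in>{j \<in> \<Pi>\<^sub>E i\<in>I. {0..D div a i - 1}. [(\<Sum>i\<in>I. a i * j i) = n] (mod D)}.
       card {q \<in> I \<rightarrow>\<^sub>E (UNIV :: nat set). (\<Sum>i\<in>I. a i * j i) + D * sum q I = n})"
    (is "card ?X = (\<Sum>j\<in>?J. card (?Q j))")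
proof -
  define b where "b i = D div a i" for i
  have ab: "a i * b i = D" and b_pos: "b i > 0" if "i \<in> I" for i
    using dvd[OF that] \<open>D > 0\<close> unfolding b_def by (auto elim!: dvdE)
  define join where "join = (\<lambda>(j, q). restrict (\<lambda>i. j i + b i * q i) I)"
  have weight: "(\<Sum>i\<in>I. a i * (j i + b i * q i)) = (\<Sum>i\<in>I. a i * j i) + D * sum q I" for j q
  proof -
    have "(\<Sum>i\<in>I. a i * (j i + b i * q i)) = (\<Sum>i\<in>I. a i * j i + D * q i)"
    proof (rule sum.cong[OF refl])
      fix i assume "i \<in> I"
      then have "a i * (b i * q i) = D * q i"
        by (simp add: ab flip: mult.assoc)
      then show "a i * (j i + b i * q i) = a i * j i + D * q i"
        by (simp add: distrib_left)
    qed
    then show ?thesis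
      by (simp add: sum.distrib sum_distrib_left)
  qed
  have small: "j i < b i" if "j \<in> ?J" "i \<in> I" for j i
  proof -
    have "j i \<in> {0..D div a i - 1}"
      using that by (auto simp: PiE_iff)
    then show ?thesis
      using b_pos[OF that(2)] by (auto simp: b_def)
  qed
  have finJ: "finite ?J"
    using \<open>finite I\<close> by (auto intro!: finite_subset[OF _ finite_PiE[of I "\<lambda>i. {0..D div a i - 1}"]])
  have finQ: "finite (?Q j)" if "j \<in> ?J" for j
  proof (rule finite_subset)
    show "?Q j \<subseteq> I \<rightarrow>\<^sub>E {..n}"
    proof
      fix q assume q: "q \<in> ?Q j"
      have "q i \<le> n" if "i \<in> I" for i
      proof -
        have "q i \<le> sum q I"
          using \<open>finite I\<close> that by (simp add: member_le_sum)
        also have "\<dots> \<le> D * sum q I"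
          using \<open>D > 0\<close> by simp
        finally show ?thesis
          using q by auto
      qed
      then show "q \<in> I \<rightarrow>\<^sub>E {..n}"
        using q by (auto simp: PiE_iff)
    qed
    show "finite (I \<rightarrow>\<^sub>E {..n})"
      using \<open>finite I\<close> by (simp add: finite_PiE)
  qed
  have "bij_betw join (Sigma ?J ?Q) ?X"
  proof (rule bij_betw_imageI)
    show "inj_on join (Sigma ?J ?Q)"
    proof (rule inj_onI)
      fix u v assume uv: "u \<in> Sigma ?J ?Q" "v \<in> Sigma ?J ?Q" "join u = join v"
      obtain j q j' q' where [simp]: "u = (j, q)" "v = (j', q')"
        by (cases u, cases v)
      have j: "j \<in> ?J" "j' \<in> ?J" and q: "q \<in> ?Q j" "q' \<in> ?Q j'"
        and eq: "join (j, q) = join (j', q')"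
        using uv by auto
      have same: "j i = j' i \<and> q i = q' i" if i: "i \<in> I" for i
      proof -
        have e: "j i + b i * q i = j' i + b i * q' i"
          using fun_cong[OF eq, of i] i by (simp add: join_def)
        have "j i = (j i + b i * q i) mod b i" "j' i = (j' i + b i * q' i) mod b i"
          using small[OF j(1) i] small[OF j(2) i] by auto
        then have "j i = j' i"
          using e by simp
        then show ?thesis
          using e b_pos[OF i] by simp
      qed
      have "j = j'"
        by (rule PiE_ext[of _ I "\<lambda>i. {0..D div a i - 1}"]) (use j same in auto)
      moreover have "q = q'"
        by (rule PiE_ext[of _ I "\<lambda>i. UNIV"]) (use q same in auto)
      ultimately show "u = v"
        by simp
    qed
    show "join ` Sigma ?J ?Q = ?X"
    proof (intro equalityI subsetI)
      fix x assume "x \<in> join ` Sigma ?J ?Q"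
      then show "x \<in> ?X"
        by (auto simp: join_def weight)
    next
      fix x assume x: "x \<in> ?X"
      define j where "j = restrict (\<lambda>i. x i mod b i) I"
      define q where "q = restrict (\<lambda>i. x i div b i) I"
      have x_eq: "x i = j i + b i * q i" if "i \<in> I" for i
        using that by (simp add: j_def q_def)
      have total: "(\<Sum>i\<in>I. a i * j i) + D * sum q I = n"
      proof -
        have "(\<Sum>i\<in>I. a i * x i) = (\<Sum>i\<in>I. a i * (j i + b i * q i))"
          by (intro sum.cong refl) (simp only: x_eq)
        then show ?thesis
          using x by (simp add: weight)
      qed
      have "x i mod b i \<le> D div a i - 1" if "i \<in> I" for i
        using mod_less_divisor[OF b_pos[OF that], of "x i"] unfolding b_def by linarith
      moreover have "[(\<Sum>i\<in>I. a i * j i) = n] (mod D)"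
        unfolding total[symmetric] by (simp add: cong_def)
      ultimately have "j \<in> ?J"
        by (auto simp: j_def)
      moreover have "q \<in> ?Q j"
        using total by (auto simp: q_def)
      moreover have "join (j, q) = x"
        using x x_eq by (auto simp: join_def fun_eq_iff PiE_iff extensional_def)
      ultimately show "x \<in> join ` Sigma ?J ?Q"
        by (metis (mono_tags, lifting) SigmaI image_eqI)
    qed
  qed
  then have "card ?X = card (Sigma ?J ?Q)"
    by (simp add: bij_betw_same_card)
  also have "\<dots> = (\<Sum>j\<in>?J. card (?Q j))"
    using finJ finQ by (intro card_SigmaI) auto
  finally show ?thesis .
qed

text \<open>
  Strictness of this bound matters: a tuple with \<open>S - n = r D\<close> would fall outside the roots of the
  binomial polynomial.
\<close>

lemma residue_tuples_weight_less:
  assumes "r \<ge> 1" and "D > 0" and dvd: "\<And>i. i \<in> {1..r} \<Longrightarrow> a i dvd D"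
    and j: "j \<in> residue_tuples a r D n"
  shows "(\<Sum>i=1..r. a i * j i) < r * D"
proof -
  have "(\<Sum>i=1..r. a i * j i) < (\<Sum>i=1..r. D)"
  proof (rule sum_strict_mono)
    fix i assume i: "i \<in> {1..r}"
    then obtain b where b: "D = a i * b"
      using dvd by (auto elim: dvdE)
    then have pos: "a i > 0" "b > 0"
      using \<open>D > 0\<close> by auto
    have "j i \<in> {0..D div a i - 1}"
      using j i by (auto simp: residue_tuples_def PiE_iff)
    then have "j i < b"
      using pos b by auto
    then show "a i * j i < D"
      using pos b by simp
  qed (use \<open>r \<ge> 1\<close> in auto)
  then show ?thesis by simp
qed

section \<open>The binomial polynomial\<close>

text \<open>
  The polynomial identity extends stars and bars below zero: for \<open>n < S\<close> the left side is \<open>0\<close>, and the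
  argument \<open>(n - S) / D\<close> is a negative integer greater than \<open>-r\<close>, where the rising factorial
  vanishes.
\<close>

lemma card_quotients_eq_pochhammer:
  fixes r D S n :: nat
  assumes "r \<ge> 1" and "D > 0" and cong: "[S = n] (mod D)" and less: "S < r * D"
  shows "real (card {q \<in> {1..r} \<rightarrow>\<^sub>E (UNIV :: nat set). S + D * sum q {1..r} = n}) =
    pochhammer ((real n - real S) / real D + 1) (r - 1) / fact (r - 1)"
proof (cases "S \<le> n")
  case True
  then obtain N where N: "n = N * D + S"
    using cong_sym[OF cong] cong_le_nat by blast
  have "{q \<in> {1..r} \<rightarrow>\<^sub>E (UNIV :: nat set). S + D * sum q {1..r} = n}
      = {q \<in> {1..r} \<rightarrow>\<^sub>E UNIV. sum q {1..r} = N}"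
    using \<open>D > 0\<close> by (simp add: N)
  moreover have "card \<dots> = (N + (r - 1)) choose (r - 1)"
    using \<open>r \<ge> 1\<close> binomial_symmetric[of N "N + (r - 1)"] by (simp add: card_fun_sum_eq)
  moreover have "real ((N + (r - 1)) choose (r - 1)) =
      pochhammer (real N + 1) (r - 1) / fact (r - 1)"
    by (simp add: binomial_gbinomial gbinomial_pochhammer')
  moreover have "(real n - real S) / real D = real N"
    using \<open>D > 0\<close> by (simp add: N)
  ultimately show ?thesis by simp
next
  case False
  then obtain t where t: "S = t * D + n"
    using cong cong_le_nat[of n S D] by auto
  have "t \<noteq> 0"
    using False t by (cases t) auto
  have "t * D < r * D"
    using less t by linarith
  then have "t < r"
    by simp
  have "(real n - real S) / real D + 1 = - real (t - 1)"
    using \<open>D > 0\<close> \<open>t \<noteq> 0\<close> by (simp add: t of_nat_diff)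
  moreover have "pochhammer (- real (t - 1)) (r - 1) = 0"
    using \<open>t \<noteq> 0\<close> \<open>t < r\<close> by (subst pochhammer_of_nat_eq_0_iff) simp
  moreover have "{q \<in> {1..r} \<rightarrow>\<^sub>E (UNIV :: nat set). S + D * sum q {1..r} = n} = {}"
    using False by auto
  ultimately show ?thesis by (simp only: card.empty of_nat_0 div_0)
qed

text \<open>
  Multiplied by \<open>x\<close>, this is the known expansion of \<open>x (x + 1) \<dots> (x + r - 1)\<close> in Stirling numbers
  of the first kind; cancelling \<open>x\<close> shifts the lower index by one and leaves the value at \<open>0\<close> to be
  compared separately.
\<close>

lemma pochhammer_eq_sum_rising_stirling:
  fixes x :: real
  assumes "r \<ge> 1"
  shows "pochhammer (x + 1) (r - 1) = (\<Sum>k\<le>r - 1. real (rising_stirling r k) * x ^ k)"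
proof -
  obtain s where r: "r = Suc s"
    using assms by (cases r) auto
  have "pochhammer (x + 1) s = (\<Sum>k\<le>s. real (stirling (Suc s) (Suc k)) * x ^ k)"
  proof (cases "x = 0")
    case True
    then show ?thesis
      by (simp add: power_0_left pochhammer_fact[symmetric] sum.atMost_shift stirling_Suc_n_1
          del: stirling.simps)
  next
    case False
    have "x * pochhammer (x + 1) s = pochhammer x (Suc s)"
      by (simp add: pochhammer_rec)
    also have "\<dots> = (\<Sum>k\<le>Suc s. real (stirling (Suc s) k) * x ^ k)"
      by (rule stirling_pochhammer[symmetric])
    also have "\<dots> = x * (\<Sum>k\<le>s. real (stirling (Suc s) (Suc k)) * x ^ k)"
      by (subst sum.atMost_Suc_shift) (simp add: sum_distrib_left mult_ac del: stirling.simps(4))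
    finally show ?thesis
      using False by simp
  qed
  then show ?thesis
    using assms by (simp add: r rising_stirling_eq_stirling del: stirling.simps)
qed

lemma sum_power_diff_div_expand:
  fixes c :: "nat \<Rightarrow> real" and y s D :: real
  shows "(\<Sum>k\<le>R. c k * ((y - s) / D) ^ k) =
    (\<Sum>m=0..R. \<Sum>k=m..R.
       c k * (-1) ^ (k - m) * real (k choose m) * (1 / D ^ k) * s ^ (k - m) * y ^ m)"
proof -
  let ?t = "\<lambda>k m. c k * (-1) ^ (k - m) * real (k choose m) * (1 / D ^ k) * s ^ (k - m) * y ^ m"
  have "c k * ((y - s) / D) ^ k = (\<Sum>m\<le>k. ?t k m)" for k
  proof -
    have "(y - s) ^ k = (\<Sum>m\<le>k. real (k choose m) * y ^ m * (- s) ^ (k - m))"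
      using binomial_ring[of y "- s" k] by simp
    then show ?thesis
      by (simp add: power_divide sum_distrib_left sum_divide_distrib power_minus[of s] mult_ac)
  qed
  then have "(\<Sum>k\<le>R. c k * ((y - s) / D) ^ k) = (\<Sum>k\<in>{..R}. \<Sum>m | m \<in> {..R} \<and> m \<le> k. ?t k m)"
    by (auto intro!: sum.cong)
  also have "\<dots> = (\<Sum>m\<in>{..R}. \<Sum>k | k \<in> {..R} \<and> m \<le> k. ?t k m)"
    by (rule sum.swap_restrict) auto
  also have "\<dots> = (\<Sum>m=0..R. \<Sum>k=m..R. ?t k m)"
    by (auto intro!: sum.cong)
  finally show ?thesis .
qed

section \<open>Uniqueness of quasi-polynomial coefficients\<close>

text \<open>
  Along the progression \<open>n + t D\<close> all coefficients are constant, so there two representations are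
  ordinary polynomials that agree at infinitely many points.
\<close>

lemma quasi_poly_rep_unique:
  assumes "D > 0" and d: "quasi_poly_rep f r D d" and e: "quasi_poly_rep f r D e" and "m < r"
  shows "d m n = e m n"
proof -
  have shift: "g k (n + t * D) = g k n" if "quasi_poly_rep f r D g" "k < r" for g k t
  proof (induction t)
    case (Suc t)
    have "g k (n + Suc t * D) = g k ((n + t * D) + D)"
      by (simp add: algebra_simps)
    with Suc that show ?case
      by (simp add: quasi_poly_rep_def)
  qed simp
  define p where "p = (\<Sum>k<r. monom (d k n - e k n) k)"
  have "poly p (real (n + t * D)) = 0" for t
  proof -
    have "(\<Sum>k<r. d k n * real (n + t * D) ^ k) = f (n + t * D)"
      using d shift[OF d] by (simp add: quasi_poly_rep_def)
    moreover have "(\<Sum>k<r. e k n * real (n + t * D) ^ k) = f (n + t * D)"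
      using e shift[OF e] by (simp add: quasi_poly_rep_def)
    ultimately show ?thesis
      by (simp add: p_def poly_sum poly_monom left_diff_distrib sum_subtractf)
  qed
  then have "range (\<lambda>t. real (n + t * D)) \<subseteq> {x. poly p x = 0}"
    by auto
  moreover have "inj (\<lambda>t. real (n + t * D))"
    using \<open>D > 0\<close> by (auto intro!: injI)
  ultimately have "infinite {x. poly p x = 0}"
    using finite_subset range_inj_infinite by blast
  then have "p = 0"
    using poly_roots_finite by blast
  moreover have "coeff p m = d m n - e m n"
    using \<open>m < r\<close> by (simp add: p_def coeff_sum)
  ultimately show ?thesis by simp
qed

lemma quasi_poly_coeff_eqI:
  assumes "D > 0" and d: "quasi_poly_rep f r D d" and "m < r"
  shows "quasi_poly_coeff f r D m n = d m n"
proof -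
  \<comment> \<open>The definite description concerns families that vanish for all indices from \<open>r\<close> on.\<close>
  define d' where "d' = (\<lambda>m n. if m < r then d m n else 0)"
  have d': "quasi_poly_rep f r D d'"
    using d by (simp add: quasi_poly_rep_def d'_def)
  have "quasi_poly_coeff f r D = d'"
    unfolding quasi_poly_coeff_def
  proof (rule the_equality)
    fix e assume e: "quasi_poly_rep f r D e \<and> (\<forall>m\<ge>r. \<forall>n. e m n = 0)"
    show "e = d'"
    proof (intro ext)
      fix k l
      show "e k l = d' k l"
        using quasi_poly_rep_unique[OF \<open>D > 0\<close> _ d', of e k l] e
        by (cases "k < r") (auto simp: d'_def)
    qed
  qed (use d' in \<open>auto simp: d'_def\<close>)
  then show ?thesis
    using \<open>m < r\<close> by (simp add: d'_def)
qed

section \<open>The formula for the coefficients\<close>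

theorem theorem1p8:
  fixes r D :: nat and a :: "nat \<Rightarrow> nat"
  assumes "r \<ge> 1"
    and "\<And>i. i \<in> {1..r} \<Longrightarrow> a i > 0"
    and "D > 0"
    and "\<And>i. i \<in> {1..r} \<Longrightarrow> a i dvd D"
  shows "(\<forall>m n. m \<le> r - 1 \<longrightarrow>
      partition_coeff a r D m n =
        1 / fact (r - 1) *
        (\<Sum>j\<in>residue_tuples a r D n. \<Sum>k=m..r-1.
           real (rising_stirling r k) * (-1) ^ (k - m) * real (k choose m) *
           (1 / real D ^ k) * real (\<Sum>i=1..r. a i * j i) ^ (k - m))) \<and>
     (\<forall>n. real (restricted_partition a r n) =
        1 / fact (r - 1) *
        (\<Sum>m=0..r-1. \<Sum>j\<in>residue_tuples a r D n. \<Sum>k=m..r-1.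
           real (rising_stirling r k) * (-1) ^ (k - m) * real (k choose m) *
           (1 / real D ^ k) * real (\<Sum>i=1..r. a i * j i) ^ (k - m) * real n ^ m))"
proof -
  define S where "S j = (\<Sum>i=1..r. a i * j i)" for j
  define t where "t m k s = real (rising_stirling r k) * (-1) ^ (k - m) * real (k choose m) *
      (1 / real D ^ k) * real s ^ (k - m)" for m k s
  define c where "c m n = 1 / fact (r - 1) *
      (\<Sum>j\<in>residue_tuples a r D n. \<Sum>k=m..r-1. t m k (S j))" for m n
  have formula: "real (restricted_partition a r n) = 1 / fact (r - 1) *
      (\<Sum>m=0..r-1. \<Sum>j\<in>residue_tuples a r D n. \<Sum>k=m..r-1. t m k (S j) * real n ^ m)" for n
  proof -
    have "real (restricted_partition a r n) =
        (\<Sum>j\<in>residue_tuples a r D n.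
           real (card {q \<in> {1..r} \<rightarrow>\<^sub>E (UNIV :: nat set). S j + D * sum q {1..r} = n}))"
      using card_solutions_by_residues[of "{1..r}" D a n] assms
      by (simp add: restricted_partition_def residue_tuples_def S_def)
    also have "\<dots> = (\<Sum>j\<in>residue_tuples a r D n.
        pochhammer ((real n - real (S j)) / real D + 1) (r - 1) / fact (r - 1))"
    proof (intro sum.cong refl card_quotients_eq_pochhammer)
      fix j assume j: "j \<in> residue_tuples a r D n"
      show "[S j = n] (mod D)"
        using j by (simp add: residue_tuples_def S_def)
      show "S j < r * D"
        unfolding S_def using assms j by (intro residue_tuples_weight_less) auto
    qed (use assms in auto)
    also have "\<dots> = 1 / fact (r - 1) * (\<Sum>j\<in>residue_tuples a r D n.
        \<Sum>m=0..r-1. \<Sum>k=m..r-1. t m k (S j) * real n ^ m)"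
      unfolding pochhammer_eq_sum_rising_stirling[OF \<open>r \<ge> 1\<close>] sum_power_diff_div_expand t_def
      by (simp add: sum_divide_distrib)
    also have "(\<Sum>j\<in>residue_tuples a r D n. \<Sum>m=0..r-1. \<Sum>k=m..r-1. t m k (S j) * real n ^ m) =
        (\<Sum>m=0..r-1. \<Sum>j\<in>residue_tuples a r D n. \<Sum>k=m..r-1. t m k (S j) * real n ^ m)"
      by (rule sum.swap)
    finally show ?thesis .
  qed
  have "quasi_poly_rep (\<lambda>n. real (restricted_partition a r n)) r D c"
    unfolding quasi_poly_rep_def
  proof (intro conjI allI impI)
    fix m n
    have "residue_tuples a r D (n + D) = residue_tuples a r D n"
      by (simp add: residue_tuples_def cong_def)
    then show "c m (n + D) = c m n"
      by (simp add: c_def)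
  next
    fix n
    have "{0..r-1} = {..<r}"
      using \<open>r \<ge> 1\<close> by auto
    then show "real (restricted_partition a r n) = (\<Sum>m<r. c m n * real n ^ m)"
      by (simp add: formula c_def sum_distrib_left sum_distrib_right mult.assoc)
  qed
  then have "partition_coeff a r D m n = c m n" if "m \<le> r - 1" for m n
    unfolding partition_coeff_def
    using quasi_poly_coeff_eqI[OF \<open>D > 0\<close>] that \<open>r \<ge> 1\<close> by simp
  with formula show ?thesis
    by (simp add: c_def t_def S_def)
qed

end
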